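(* Let $F$ be a field. Let $k,\ell$ be integers with $k>0$ and $0\le \ell\le k$. Let $m_1,\dots,m_k$ be positive integers such that exactly $\ell$ of them are odd and $k-\ell$ of them are even, and put $N_{k,\ell}=\sum_{i=1}^k m_i-2k+\ell+2$. Then there exists a unital associative $F$-algebra $A$ such that: (i) $T^{(1+N_{k,\ell})}(A)=0$, i.e. $[u_1,\dots,u_{1+N_{k,\ell}}]=0$ for all $u_i\in A$ ($A$ is Lie nilpotent of class at most $N_{k,\ell}$); (ii) there exist elements $v_{ij}\in A$ ($1\le i\le k$, $1\le j\le m_i$) such that \[ [v_{11},\dots,v_{1m_1}]\,[v_{21},\dots,v_{2m_2}]\cdots[v_{k1},\dots,v_{km_k}]\neq 0. \]
   Context: For an associative algebra $A$, left-normed commutators are defined by $[a_1,a_2]=a_1a_2-a_2a_1$ and $[a_1,\dots,a_{n-1},a_n]=[[a_1,\dots,a_{n-1}],a_n]$ for $n\ge 3$; a commutator $[a_1]$ of length one is just $a_1$. For $n\ge 2$, $T^{(n)}(A)$ denotes the two-sided ideal of $A$ generated by all commutators $[a_1,\dots,a_n]$ with $a_i\in A$, and $T^{(1)}(A)=A$. *)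

theory Defs
  imports "HOL-Algebra.Ideal"
begin

definition unital_F_algebra :: "('f::field \<Rightarrow> 'b \<Rightarrow> 'b) \<Rightarrow> 'b ring \<Rightarrow> bool" where
  "unital_F_algebra sm A \<longleftrightarrow>
     ring A \<and>
     (\<forall>c x. x \<in> carrier A \<longrightarrow> sm c x \<in> carrier A) \<and>
     (\<forall>c d x. x \<in> carrier A \<longrightarrow> sm (c + d) x = sm c x \<oplus>\<^bsub>A\<^esub> sm d x) \<and>
     (\<forall>c x y. x \<in> carrier A \<longrightarrow> y \<in> carrier A \<longrightarrow>
                sm c (x \<oplus>\<^bsub>A\<^esub> y) = sm c x \<oplus>\<^bsub>A\<^esub> sm c y) \<and>
     (\<forall>c d x. x \<in> carrier A \<longrightarrow> sm (c * d) x = sm c (sm d x)) \<and>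
     (\<forall>x. x \<in> carrier A \<longrightarrow> sm 1 x = x) \<and>
     (\<forall>c x y. x \<in> carrier A \<longrightarrow> y \<in> carrier A \<longrightarrow>
                sm c (x \<otimes>\<^bsub>A\<^esub> y) = sm c x \<otimes>\<^bsub>A\<^esub> y) \<and>
     (\<forall>c x y. x \<in> carrier A \<longrightarrow> y \<in> carrier A \<longrightarrow>
                sm c (x \<otimes>\<^bsub>A\<^esub> y) = x \<otimes>\<^bsub>A\<^esub> sm c y)"

definition comm2 :: "('b, 'm) ring_scheme \<Rightarrow> 'b \<Rightarrow> 'b \<Rightarrow> 'b" where
  "comm2 A a b = (a \<otimes>\<^bsub>A\<^esub> b) \<ominus>\<^bsub>A\<^esub> (b \<otimes>\<^bsub>A\<^esub> a)"

fun lcomm :: "('b, 'm) ring_scheme \<Rightarrow> 'b list \<Rightarrow> 'b" where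
  "lcomm A [] = \<zero>\<^bsub>A\<^esub>"
| "lcomm A (a # as) = foldl (comm2 A) a as"

definition Tn :: "nat \<Rightarrow> ('b, 'm) ring_scheme \<Rightarrow> 'b set" where
  "Tn n A = (if n \<le> 1 then carrier A
             else genideal A {lcomm A us | us. length us = n \<and> set us \<subseteq> carrier A})"

end

theory Submission
  imports Defs "HOL-Algebra.Weak_Morphisms" "HOL-Library.Nat_Bijection"
begin

text \<open>
  Let \<open>c\<^sub>0, c\<^sub>1, \<dots>\<close> be Grassmann variables, let \<open>s\<close> be the sum of the \<open>(m\<^sub>i - 1) div 2\<close>, and call the
  variables with index below \<open>2 s\<close> low and the others high. The algebra has a basis of monomials \<open>g\<^sub>S\<close>
  (\<open>S\<close> a finite set of indices) over the commutative even part of the Grassmann algebra, with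
  \<open>g\<^sub>S g\<^sub>T = \<lambda>(S, T) g\<^bsub>S \<union> T\<^esub>\<close> for disjoint \<open>S\<close>, \<open>T\<close> and \<open>0\<close> otherwise. Here \<open>\<lambda>\<close> is a bicharacter with
  \<open>\<lambda>(S, T) = \<lambda>(T, S) (1 + x\<^sub>S x\<^sub>T) (1 + y\<^sub>S y\<^sub>T)\<close>, where \<open>x\<^sub>S\<close> and \<open>y\<^sub>S\<close> are the sums of the high and of the
  low variables with index in \<open>S\<close>; it exists in every characteristic.

  A left-normed commutator of monomials is therefore a unit times the product of the
  \<open>(1 + x\<^sub>S x\<^sub>T) (1 + y\<^sub>S y\<^sub>T) - 1\<close>, with \<open>S\<close> and \<open>T\<close> two consecutive partial unions of the index sets (since
  \<open>x\<^sub>S\<^sup>2 = 0\<close>). Because \<open>x\<^sub>S x\<^sub>T x\<^sub>T x\<^sub>U = 0\<close>, the factors \<open>x x\<close> and \<open>y y\<close> must alternate, so a commutator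
  of length \<open>2 s + 3\<close> contains \<open>s + 1\<close> factors of degree two in the \<open>2 s\<close> low variables and vanishes. On the
  other hand a commutator of length \<open>m\<close> can be chosen to be a unit times a Grassmann monomial with
  only \<open>2 ((m - 1) div 2)\<close> low variables, so there are enough of them for the product in question.
\<close>

section \<open>Twisted subset convolution\<close>

text \<open>A sum over an infinite index set is zero, so the value at an infinite \<open>S\<close>
  is zero by default.\<close>

definition conv :: "('a set \<Rightarrow> 'a set \<Rightarrow> 'r::comm_ring_1) \<Rightarrow> ('a set \<Rightarrow> 'r) \<Rightarrow> ('a set \<Rightarrow> 'r) \<Rightarrow> 'a set \<Rightarrow> 'r"
  where "conv b f g S = (\<Sum>T\<in>Pow S. b T (S - T) * f T * g (S - T))"

definition mono_at :: "'r::zero \<Rightarrow> 'a set \<Rightarrow> 'a set \<Rightarrow> 'r"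
  where "mono_at c A S = (if S = A then c else 0)"

text \<open>The condition concerns each index set and not their number: infinitely many finite sets
  may carry nonzero values. Products still make sense because a finite set has finitely many
  subsets.\<close>

definition finsupp :: "('a set \<Rightarrow> 'r::zero) set"
  where "finsupp = {f. \<forall>S. infinite S \<longrightarrow> f S = 0}"

lemma finsuppI: "(\<And>S. infinite S \<Longrightarrow> f S = 0) \<Longrightarrow> f \<in> finsupp"
  by (simp add: finsupp_def)

lemma finsuppD: "f \<in> finsupp \<Longrightarrow> infinite S \<Longrightarrow> f S = 0"
  by (simp add: finsupp_def)

lemma conv_infinite: "infinite S \<Longrightarrow> conv b f g S = 0"
  by (simp add: conv_def)

lemma conv_finsupp [simp]: "conv b f g \<in> finsupp"
  by (simp add: finsuppI conv_infinite)

lemma mono_at_finsupp [simp]: "finite A \<Longrightarrow> mono_at c A \<in> finsupp"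
  by (auto simp: finsupp_def mono_at_def)

lemma conv_add_left: "conv b (\<lambda>S. f S + g S) h S = conv b f h S + conv b g h S"
  by (simp add: conv_def algebra_simps sum.distrib)

lemma conv_add_right: "conv b h (\<lambda>S. f S + g S) S = conv b h f S + conv b h g S"
  by (simp add: conv_def algebra_simps sum.distrib)

lemma conv_scale_left: "conv b (\<lambda>S. c * f S) h S = c * conv b f h S"
  by (simp add: conv_def algebra_simps sum_distrib_left)

lemma conv_scale_right: "conv b h (\<lambda>S. c * f S) S = c * conv b h f S"
  by (simp add: conv_def algebra_simps sum_distrib_left)

lemma conv_flip: "conv b g f S = (\<Sum>T\<in>Pow S. b (S - T) T * f T * g (S - T))"
  unfolding conv_def
  by (rule sum.reindex_bij_witness[where i = "\<lambda>T. S - T" and j = "\<lambda>T. S - T"])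
    (auto simp: double_diff)

lemma conv_mono_at_disjoint:
  assumes "finite A" "finite B" "A \<inter> B = {}"
  shows "conv b (mono_at c A) (mono_at d B) = mono_at (b A B * c * d) (A \<union> B)"
proof
  fix S
  have "conv b (mono_at c A) (mono_at d B) S
      = (\<Sum>T\<in>Pow S. if T = A then b A (S - A) * c * mono_at d B (S - A) else 0)"
    unfolding conv_def by (rule sum.cong) (auto simp: mono_at_def)
  also have "\<dots> = mono_at (b A B * c * d) (A \<union> B) S"
  proof (cases "finite S")
    case True
    moreover have "A \<subseteq> S \<and> S - A = B \<longleftrightarrow> S = A \<union> B"
      using assms(3) by auto
    ultimately show ?thesis
      by (auto simp: mono_at_def)
  next
    case False
    then show ?thesis using assms by (auto simp: mono_at_def)
  qed
  finally show "conv b (mono_at c A) (mono_at d B) S = mono_at (b A B * c * d) (A \<union> B) S" .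
qed

lemma conv_mono_at_meet:
  assumes "A \<inter> B \<noteq> {}"
  shows "conv b (mono_at c A) (mono_at d B) S = 0"
  unfolding conv_def by (rule sum.neutral) (use assms in \<open>auto simp: mono_at_def\<close>)

locale bicharacter =
  fixes b :: "'a set \<Rightarrow> 'a set \<Rightarrow> 'r::comm_ring_1"
  assumes union_left: "\<lbrakk>finite A; finite B; finite C; A \<inter> B = {}\<rbrakk> \<Longrightarrow> b (A \<union> B) C = b A C * b B C"
    and union_right: "\<lbrakk>finite A; finite B; finite C; A \<inter> B = {}\<rbrakk> \<Longrightarrow> b C (A \<union> B) = b C A * b C B"
    and empty_left: "b {} A = 1"
    and empty_right: "b A {} = 1"
begin

text \<open>Both sides sum over the ordered partitions of \<open>S\<close> into blocks
  \<open>U\<close>, \<open>V\<close>, \<open>R\<close>, and both weights expand to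
  \<open>b U V * b U R * b V R\<close>.\<close>

lemma conv_assoc: "conv b (conv b f g) h = conv b f (conv b g h)"
proof
  fix S
  show "conv b (conv b f g) h S = conv b f (conv b g h) S"
  proof (cases "finite S")
    case fin: True
    have "conv b (conv b f g) h S
        = (\<Sum>T\<in>Pow S. \<Sum>U\<in>Pow T. b T (S - T) * (b U (T - U) * f U * g (T - U)) * h (S - T))"
      by (simp add: conv_def sum_distrib_left sum_distrib_right)
    also have "\<dots> = (\<Sum>(T, U)\<in>Sigma (Pow S) Pow.
        b T (S - T) * (b U (T - U) * f U * g (T - U)) * h (S - T))"
      by (rule sum.Sigma) (use fin in \<open>auto intro: finite_subset\<close>)
    also have "\<dots> = (\<Sum>(U, V)\<in>Sigma (Pow S) (\<lambda>U. Pow (S - U)).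
        b U (S - U) * f U * (b V (S - U - V) * g V * h (S - U - V)))"
    \<comment> \<open>A chain \<open>U\<close> \<subseteq> \<open>T\<close> \<subseteq>
      \<open>S\<close> corresponds to the blocks \<open>U\<close>, \<open>T - U\<close> and
      \<open>S - T\<close>.\<close>
    proof (rule sum.reindex_bij_witness[where i = "\<lambda>(U, V). (U \<union> V, U)" and j = "\<lambda>(T, U). (U, T - U)"],
        goal_cases)
      case (5 x)
      then obtain T U where x: "x = (T, U)" "T \<subseteq> S" "U \<subseteq> T" by auto
      define V R where "V = T - U" and "R = S - T"
      have e: "T = U \<union> V" "S - U = V \<union> R" "S - U - V = R" "U \<inter> V = {}" "V \<inter> R = {}" "T - U = V" "S - T = R"
        using x by (auto simp: V_def R_def)
      have f: "finite U" "finite V" "finite R"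
        using x fin by (auto simp: V_def R_def intro: finite_subset)
      have "b T R * b U V = b U (V \<union> R) * b V R"
        using e f by (simp add: union_left union_right mult_ac)
      then have "b T R * b U V * (f U * g V * h R) = b U (V \<union> R) * b V R * (f U * g V * h R)" by simp
      then show ?case using x e by (simp add: mult_ac)
    qed auto
    also have "\<dots> = (\<Sum>U\<in>Pow S. \<Sum>V\<in>Pow (S - U). b U (S - U) * f U * (b V (S - U - V) * g V * h (S - U - V)))"
      by (rule sum.Sigma[symmetric]) (use fin in auto)
    also have "\<dots> = conv b f (conv b g h) S"
      by (simp add: conv_def sum_distrib_left)
    finally show ?thesis .
  qed (simp add: conv_infinite)
qed

lemma conv_one_left: "f \<in> finsupp \<Longrightarrow> conv b (mono_at 1 {}) f = f"
proof
  fix S assume f: "f \<in> finsupp"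
  have "conv b (mono_at 1 {}) f S = (\<Sum>T\<in>Pow S. if T = {} then f S else 0)"
    unfolding conv_def by (rule sum.cong) (auto simp: mono_at_def empty_left)
  then show "conv b (mono_at 1 {}) f S = f S"
    using f by (cases "finite S") (auto simp: finsuppD)
qed

lemma conv_one_right: "f \<in> finsupp \<Longrightarrow> conv b f (mono_at 1 {}) = f"
proof
  fix S assume f: "f \<in> finsupp"
  have "conv b f (mono_at 1 {}) S = (\<Sum>T\<in>Pow S. if T = S then f S else 0)"
    unfolding conv_def by (rule sum.cong) (auto simp: mono_at_def empty_right)
  then show "conv b f (mono_at 1 {}) S = f S"
    using f by (cases "finite S") (auto simp: finsuppD)
qed

end

section \<open>The even part of the Grassmann algebra\<close>

text \<open>The sign that sorts the juxtaposition of two increasing Grassmann monomials.\<close>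

definition perm_sign :: "nat set \<Rightarrow> nat set \<Rightarrow> 'f::comm_ring_1"
  where "perm_sign A B = (\<Prod>i\<in>A. \<Prod>j\<in>B. if j < i then - 1 else 1)"

interpretation sign: bicharacter perm_sign
  by standard (auto simp: perm_sign_def prod.union_disjoint prod.distrib)

lemma perm_sign_square: "perm_sign A B * perm_sign A B = 1"
  unfolding perm_sign_def prod.distrib[symmetric] by (intro prod.neutral ballI) auto

text \<open>For disjoint sets every pair is out of order in exactly one of the two products, which
  gives one sign per pair.\<close>

lemma perm_sign_swap:
  assumes "finite A" "finite B" "A \<inter> B = {}"
  shows "perm_sign A B * perm_sign B A = (- 1) ^ (card A * card B)"
proof -
  have "perm_sign B A = (\<Prod>i\<in>A. \<Prod>j\<in>B. if i < j then - 1 else (1 :: 'a))"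
    unfolding perm_sign_def by (rule prod.swap)
  then have "perm_sign A B * perm_sign B A
      = (\<Prod>i\<in>A. \<Prod>j\<in>B. (if j < i then - 1 else 1) * (if i < j then - 1 else (1 :: 'a)))"
    by (simp add: perm_sign_def prod.distrib)
  also have "\<dots> = (\<Prod>i\<in>A. \<Prod>j\<in>B. - 1)"
    using assms(3) by (intro prod.cong refl) (auto simp: not_less_iff_gr_or_eq)
  finally show ?thesis
    by (simp flip: power_mult add: mult.commute)
qed

lemma perm_sign_even:
  assumes "finite A" "finite B" "A \<inter> B = {}" "even (card A)"
  shows "perm_sign A B = perm_sign B A"
proof -
  have "perm_sign A B * perm_sign B A = (1 :: 'a)"
    using perm_sign_swap[OF assms(1-3)] assms(4) by simp
  then have "perm_sign A B * (perm_sign B A * perm_sign B A) = (perm_sign B A :: 'a)"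
    by (simp flip: mult.assoc)
  then show ?thesis by (simp add: perm_sign_square)
qed

text \<open>Keeping only the even monomials gives a commutative ring, which can then be the
  coefficient ring of a second, twisted convolution.\<close>

typedef (overloaded) ('f::comm_ring_1) grass =
  "{f :: nat set \<Rightarrow> 'f. \<forall>S. f S \<noteq> 0 \<longrightarrow> finite S \<and> even (card S)}"
  morphisms coef Grass
  by (rule exI[of _ "\<lambda>_. 0"]) simp

setup_lifting type_definition_grass

lemma coef_nonzeroD: "coef x S \<noteq> 0 \<Longrightarrow> finite S \<and> even (card S)"
  using coef[of x] by auto

lemma coef_finsupp: "coef x \<in> finsupp"
  using coef_nonzeroD by (auto simp: finsupp_def)

lemma even_conv:
  fixes f g :: "nat set \<Rightarrow> 'f::comm_ring_1"
  assumes "\<And>S. f S \<noteq> 0 \<Longrightarrow> finite S \<and> even (card S)" "\<And>S. g S \<noteq> 0 \<Longrightarrow> finite S \<and> even (card S)"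
    and "conv perm_sign f g S \<noteq> 0"
  shows "finite S \<and> even (card S)"
proof -
  have "finite S" using assms(3) conv_infinite by auto
  have "\<exists>T\<in>Pow S. perm_sign T (S - T) * f T * g (S - T) \<noteq> 0"
    using assms(3) unfolding conv_def by (meson sum.neutral)
  then obtain T where T: "T \<subseteq> S" "f T \<noteq> 0" "g (S - T) \<noteq> 0"
    by (auto dest!: mult_not_zero)
  then have "even (card T + card (S - T))" using assms by auto
  also have "card T + card (S - T) = card S"
    using \<open>finite S\<close> T(1) by (simp add: card_Diff_subset card_mono finite_subset)
  finally show ?thesis using \<open>finite S\<close> by simp
qed

instantiation grass :: (comm_ring_1) comm_ring_1
begin

lift_definition zero_grass :: "'a grass" is "\<lambda>_. 0" by simp
lift_definition one_grass :: "'a grass" is "mono_at 1 {}"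
  by (auto simp: mono_at_def split: if_splits)
lift_definition plus_grass :: "'a grass \<Rightarrow> 'a grass \<Rightarrow> 'a grass" is "\<lambda>f g S. f S + g S"
  by (metis add.right_neutral)
lift_definition minus_grass :: "'a grass \<Rightarrow> 'a grass \<Rightarrow> 'a grass" is "\<lambda>f g S. f S - g S"
  by (metis diff_zero)
lift_definition uminus_grass :: "'a grass \<Rightarrow> 'a grass" is "\<lambda>f S. - f S" by simp
lift_definition times_grass :: "'a grass \<Rightarrow> 'a grass \<Rightarrow> 'a grass" is "conv perm_sign"
  by (metis (full_types) even_conv)

instance
proof
  fix a b c :: "'a grass"
  show "a * b * c = a * (b * c)" by transfer (simp add: sign.conv_assoc)
  show "a * b = b * a"
  proof transfer
    fix f g :: "nat set \<Rightarrow> 'a"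
    assume f: "\<forall>S. f S \<noteq> 0 \<longrightarrow> finite S \<and> even (card S)" and g: "\<forall>S. g S \<noteq> 0 \<longrightarrow> finite S \<and> even (card S)"
    \<comment> \<open>The two signs can differ only for odd \<open>T\<close>, where
      \<open>f T\<close> is zero.\<close>
    have "perm_sign T (S - T) * f T * g (S - T) = perm_sign (S - T) T * f T * g (S - T)" for S T
      using f g perm_sign_even[of T "S - T", where 'a = 'a] by (cases "f T = 0 \<or> g (S - T) = 0") auto
    then show "conv perm_sign f g = conv perm_sign g f"
      by (intro ext) (simp add: conv_flip[of _ g f], simp add: conv_def)
  qed
  show "1 * a = a" by transfer (rule sign.conv_one_left, auto simp: finsupp_def)
  show "(a + b) * c = a * c + b * c" by transfer (auto simp: conv_add_left)
  show "0 \<noteq> (1 :: 'a grass)" by transfer (auto simp: mono_at_def fun_eq_iff)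
qed (transfer, simp add: algebra_simps; fail)+

end

section \<open>Coefficients, monomials and scalar multiples in the Grassmann algebra\<close>

lemma coef_simps [simp]:
  "coef 0 S = 0" "coef (x + y) S = coef x S + coef y S" "coef (x - y) S = coef x S - coef y S" "coef (- x) S = - coef x S"
  by (transfer, simp)+

lemma coef_times: "coef (x * y) = conv perm_sign (coef x) (coef y)"
  by transfer simp

lemma grass_eqI: "(\<And>S. coef x S = coef y S) \<Longrightarrow> x = y"
  by transfer auto

lift_definition gmon :: "nat set \<Rightarrow> 'f::comm_ring_1 grass"
  is "\<lambda>P. if finite P \<and> even (card P) then mono_at 1 P else (\<lambda>_. 0)"
  by (auto simp: mono_at_def split: if_splits)

lift_definition gscale :: "'f::comm_ring_1 \<Rightarrow> 'f grass \<Rightarrow> 'f grass" is "\<lambda>c f S. c * f S"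
  by force

lemma coef_gmon: "finite P \<Longrightarrow> even (card P) \<Longrightarrow> coef (gmon P) = mono_at 1 P"
  by transfer simp

lemma coef_gscale [simp]: "coef (gscale c x) S = c * coef x S"
  by transfer simp

lemma gscale_times: "gscale c (x * y) = gscale c x * y"
  by (rule grass_eqI) (simp add: coef_times conv_scale_left gscale.rep_eq)

lemma gmon_nonzero: "finite P \<Longrightarrow> even (card P) \<Longrightarrow> gmon P \<noteq> (0 :: 'f::comm_ring_1 grass)"
  by transfer (auto simp: mono_at_def fun_eq_iff)

lemma gmon_mult_disjoint:
  assumes "finite P" "even (card P)" "finite Q" "even (card Q)" "P \<inter> Q = {}"
  shows "gmon P * gmon Q = gscale (perm_sign P Q) (gmon (P \<union> Q))"
proof -
  have "even (card (P \<union> Q))" using assms by (simp add: card_Un_disjoint)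
  then show ?thesis
    using assms by (intro grass_eqI)
      (simp add: coef_times coef_gmon conv_mono_at_disjoint, simp add: mono_at_def)
qed

lemma gmon_mult_meet:
  assumes "finite P" "even (card P)" "finite Q" "even (card Q)" "P \<inter> Q \<noteq> {}"
  shows "gmon P * gmon Q = 0"
  using assms by (intro grass_eqI) (simp add: coef_times coef_gmon conv_mono_at_meet)

section \<open>Bicharacters from alternating forms\<close>

text \<open>Off the diagonal the terms cancel in pairs. Assuming separately that the diagonal
  vanishes makes this valid in characteristic two.\<close>

lemma sum_alternating:
  fixes a :: "'a \<Rightarrow> 'a \<Rightarrow> 'r::ab_group_add"
  assumes "finite T" "\<And>j. a j j = 0" "\<And>j k. a j k = - a k j"
  shows "(\<Sum>j\<in>T. \<Sum>k\<in>T. a j k) = 0"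
  using assms(1)
proof induction
  case (insert x T)
  have "(\<Sum>j\<in>T. a j x) = - (\<Sum>k\<in>T. a x k)"
    by (subst assms(3)) (simp add: sum_negf)
  with insert show ?case
    by (simp add: sum.distrib assms(2))
qed simp

text \<open>The products \<open>c\<^sub>i c\<^sub>j\<close> of anticommuting square-zero elements are the model for \<open>w i j\<close>.\<close>

locale exchange_form =
  fixes w :: "nat \<Rightarrow> nat \<Rightarrow> 'r::comm_ring_1"
  assumes self: "w i i = 0"
    and anti: "w i j = - w j i"
    and chain: "w i j * w j l = 0"
    and exchange: "w i j * w k l = - (w i k * w j l)"
begin

definition W :: "nat set \<Rightarrow> nat set \<Rightarrow> 'r"
  where "W S T = (\<Sum>i\<in>S. \<Sum>j\<in>T. w i j)"

text \<open>For disjoint sets each pair of indices is counted in exactly one of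
  \<open>ordered S T\<close> and \<open>ordered T S\<close>. This produces the quotient
  \<open>1 + W S T\<close> without the division by two in the symmetric choice
  \<open>1 + W S T / 2\<close>.\<close>

definition ordered :: "nat set \<Rightarrow> nat set \<Rightarrow> 'r"
  where "ordered S T = (\<Prod>i\<in>S. 1 + W {i} {j \<in> T. j < i})"

lemma W_empty [simp]: "W {} T = 0" "W S {} = 0"
  by (simp_all add: W_def)

lemma W_union_right: "finite T \<Longrightarrow> finite U \<Longrightarrow> T \<inter> U = {} \<Longrightarrow> W S (T \<union> U) = W S T + W S U"
  by (simp add: W_def sum.union_disjoint sum.distrib)

lemma W_anti: "W S T = - W T S"
proof -
  have "W S T = (\<Sum>j\<in>T. \<Sum>i\<in>S. w i j)"
    unfolding W_def by (rule sum.swap)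
  also have "\<dots> = (\<Sum>j\<in>T. \<Sum>i\<in>S. - w j i)"
    by (intro sum.cong refl anti)
  finally show ?thesis by (simp add: W_def sum_negf)
qed

lemma W_union_left: "finite T \<Longrightarrow> finite U \<Longrightarrow> T \<inter> U = {} \<Longrightarrow> W (T \<union> U) S = W T S + W U S"
  by (simp add: W_def sum.union_disjoint)

lemma W_self: "finite S \<Longrightarrow> W S S = 0"
  unfolding W_def by (rule sum_alternating) (auto simp: self intro: anti)

text \<open>The two sides differ by \<open>W T T\<close>, which is zero. In this form the defects of
  consecutive partial unions fit into \<open>W_chain\<close>.\<close>

lemma W_diff:
  assumes "finite S" "T \<subseteq> S"
  shows "W T (S - T) = W T S"
proof -
  have "W T S = W T (T \<union> (S - T))" using assms(2) by (simp add: Un_absorb1)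
  also have "\<dots> = W T T + W T (S - T)"
    using assms finite_subset by (intro W_union_right) auto
  finally show ?thesis using W_self[OF finite_subset[OF assms(2,1)]] by simp
qed

text \<open>In the model the sum of the variables in \<open>T\<close> occurs twice and has square
  zero. Abstractly, the terms for two indices in \<open>T\<close> alternate by
  \<open>exchange\<close> and vanish on the diagonal by \<open>chain\<close>.\<close>

lemma W_chain:
  assumes "finite T"
  shows "W S T * W T U = 0"
proof -
  have "W T U = (\<Sum>k\<in>T. W {k} U)" by (simp add: W_def)
  then have eq: "W S T * W T U = (\<Sum>i\<in>S. \<Sum>j\<in>T. \<Sum>k\<in>T. w i j * W {k} U)"
    by (simp add: W_def[of S T] sum_distrib_right) (simp add: sum_distrib_left)
  have "(\<Sum>j\<in>T. \<Sum>k\<in>T. w i j * W {k} U) = 0" for i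
  proof (rule sum_alternating[OF assms])
    fix j k
    show "w i j * W {j} U = 0"
      by (simp add: W_def sum_distrib_left chain)
    show "w i j * W {k} U = - (w i k * W {j} U)"
      by (simp add: W_def sum_distrib_left exchange[of i j k] sum_negf)
  qed
  then show ?thesis by (simp add: eq)
qed

lemma W_fork: "finite T \<Longrightarrow> W T S * W T U = 0"
  using W_chain[of T S U] W_anti[of T S] by simp

lemma W_fork': "finite T \<Longrightarrow> W S T * W U T = 0"
  using W_chain[of T S U] W_anti[of U T] by simp

text \<open>On the left the product over indices splits; on the right the cross term of the two
  factors at a common index \<open>i\<close> vanishes by \<open>W_fork\<close>.\<close>

lemma bicharacter_ordered: "bicharacter ordered"
proof
  fix A B C :: "nat set"
  assume fin: "finite A" "finite B" "finite C" and "A \<inter> B = {}"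
  then show "ordered (A \<union> B) C = ordered A C * ordered B C"
    by (simp add: ordered_def prod.union_disjoint)
  show "ordered C (A \<union> B) = ordered C A * ordered C B"
    unfolding ordered_def prod.distrib[symmetric]
  proof (rule prod.cong)
    fix i
    let ?a = "{j \<in> A. j < i}" and ?b = "{j \<in> B. j < i}"
    have "{j \<in> A \<union> B. j < i} = ?a \<union> ?b" by auto
    moreover have "W {i} (?a \<union> ?b) = W {i} ?a + W {i} ?b"
      using fin \<open>A \<inter> B = {}\<close> by (intro W_union_right) auto
    moreover have "W {i} ?a * W {i} ?b = 0" by (simp add: W_fork)
    ultimately show "1 + W {i} {j \<in> A \<union> B. j < i} = (1 + W {i} ?a) * (1 + W {i} ?b)"
      by (simp add: algebra_simps)
  qed simp
qed (simp_all add: ordered_def)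

text \<open>Each factor \<open>1 + W {i} U\<close> has inverse \<open>1 - W {i} U\<close>, because
  \<open>W {i} U\<close> has square zero.\<close>

lemma ordered_unit: "ordered S T dvd 1"
proof -
  have "1 + W {i} U dvd 1" for i U
  proof
    show "1 = (1 + W {i} U) * (1 - W {i} U)"
      using W_fork[of "{i}" U U] by (simp add: algebra_simps)
  qed
  then have "ordered S T dvd (\<Prod>i\<in>S. 1)"
    unfolding ordered_def by (intro prod_dvd_prod) auto
  then show ?thesis by simp
qed

lemma ordered_insert_top:
  assumes "finite S" "\<forall>i\<in>S. i < n" "\<forall>i\<in>T. i < n"
  shows "ordered (insert n S) T = ordered S T * (1 + W {n} T)"
proof -
  have "{j \<in> T. j < n} = T" using assms by auto
  moreover have "n \<notin> S" using assms by auto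
  ultimately show ?thesis using assms(1) by (simp add: ordered_def mult.commute)
qed

lemma ordered_insert_top_right:
  assumes "\<forall>i\<in>S. i < n"
  shows "ordered S (insert n T) = ordered S T"
  unfolding ordered_def
proof (rule prod.cong)
  fix i assume "i \<in> S"
  then have "{j \<in> insert n T. j < i} = {j \<in> T. j < i}" using assms by auto
  then show "1 + W {i} {j \<in> insert n T. j < i} = 1 + W {i} {j \<in> T. j < i}" by simp
qed simp

text \<open>Induction by removing the largest index: it exceeds all the others, so its whole
  contribution goes to the ordered product that has it on the left.\<close>

lemma ordered_swap:
  assumes "S \<subseteq> {..<n}" "T \<subseteq> {..<n}" "S \<inter> T = {}"
  shows "ordered S T = ordered T S * (1 + W S T)"
  using assms
proof (induction n arbitrary: S T)
  case 0
  then show ?case by (simp add: ordered_def)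
next
  case (Suc n)
  have fin: "finite S" "finite T" using Suc.prems by (auto intro: finite_subset)
  consider (S) "n \<in> S" "n \<notin> T" | (T) "n \<in> T" "n \<notin> S" | (none) "n \<notin> S" "n \<notin> T"
    using Suc.prems by auto
  then show ?case
  proof cases
    case S
    define R where "R = S - {n}"
    have R: "S = insert n R" "n \<notin> R" "finite R" "\<forall>i\<in>R. i < n" "\<forall>i\<in>T. i < n"
      using S fin Suc.prems by (auto simp: R_def less_Suc_eq)
    have IH: "ordered R T = ordered T R * (1 + W R T)"
      using R Suc.prems by (intro Suc.IH) auto
    have "W S T = W R T + W {n} T"
      using W_union_left[of R "{n}" T] R by simp
    moreover have "W R T * W {n} T = 0"
      using fin by (simp add: W_fork')
    moreover have "ordered S T = ordered R T * (1 + W {n} T)" "ordered T S = ordered T R"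
      using R by (simp_all add: ordered_insert_top ordered_insert_top_right)
    moreover have "(1 + W R T) * (1 + W {n} T) = 1 + (W R T + W {n} T) + W R T * W {n} T"
      by (simp add: algebra_simps)
    ultimately show ?thesis using IH by (simp add: mult.assoc)
  next
    case T
    define R where "R = T - {n}"
    have R: "T = insert n R" "n \<notin> R" "finite R" "\<forall>i\<in>R. i < n" "\<forall>i\<in>S. i < n"
      using T fin Suc.prems by (auto simp: R_def less_Suc_eq)
    have IH: "ordered S R = ordered R S * (1 + W S R)"
      using R Suc.prems by (intro Suc.IH) auto
    \<comment> \<open>Moving \<open>n\<close> to the left changes the sign, so the extra factor
      \<open>1 + W {n} S\<close> of \<open>ordered T S\<close> cancels this term up to products that
      vanish.\<close>
    have "W S T = W S R - W {n} S"
      using W_union_right[of R "{n}" S] R W_anti[of S "{n}"] by simp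
    moreover have "W {n} S * W S R = 0" "W {n} S * W {n} S = 0"
      using fin by (simp_all add: W_chain W_fork)
    moreover have "ordered S T = ordered S R" "ordered T S = ordered R S * (1 + W {n} S)"
      using R by (simp_all add: ordered_insert_top ordered_insert_top_right)
    moreover have "(1 + W {n} S) * (1 + (W S R - W {n} S)) = 1 + W S R + W {n} S * W S R - W {n} S * W {n} S"
      by (simp add: algebra_simps)
    ultimately show ?thesis using IH by (simp add: mult.assoc)
  next
    case none
    then show ?thesis using Suc.prems by (intro Suc.IH) (auto simp: less_Suc_eq)
  qed
qed

end

section \<open>Products of two Grassmann variables as an exchange form\<close>

lemma exchange_form_restrict:
  assumes "exchange_form w"
  shows "exchange_form (\<lambda>i j. if Q i \<and> Q j then w i j else 0)"
proof -
  interpret exchange_form w by fact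
  \<comment> \<open>Restriction amounts to setting the variables outside \<open>Q\<close> to zero.
    Both sides of each identity involve the same indices and so vanish together.\<close>
  show ?thesis
  proof
    fix i j k l
    show "(if Q i \<and> Q j then w i j else 0) = - (if Q j \<and> Q i then w j i else 0)"
      using anti[of i j] by simp
    show "(if Q i \<and> Q j then w i j else 0) * (if Q k \<and> Q l then w k l else 0) =
       - ((if Q i \<and> Q k then w i k else 0) * (if Q j \<and> Q l then w j l else 0))"
      using exchange[of i j k l] by simp
  qed (simp_all add: self chain)
qed

text \<open>The product c_i c_j; the sign is there because \<open>gmon {i, j}\<close> is the product
  in increasing order.\<close>

definition gpair :: "nat \<Rightarrow> nat \<Rightarrow> 'f::comm_ring_1 grass"
  where "gpair i j = (if i = j then 0 else gscale (perm_sign {i} {j}) (gmon {i, j}))"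

lemma gscale_gscale: "gscale c (gscale d x) = gscale (c * d) x"
  by (rule grass_eqI) (simp add: mult.assoc)

lemma gscale_times_right: "x * gscale c y = gscale c (x * y)"
  by (metis gscale_times mult.commute)

lemma gscale_zero [simp]: "gscale c 0 = 0"
  by (rule grass_eqI) simp

lemma gpair_mult:
  assumes "distinct [i, j, k, l]"
  shows "gpair i j * gpair k l = gscale (perm_sign {i} {j} * perm_sign {k} {l}
    * perm_sign {i} {k} * perm_sign {i} {l} * perm_sign {j} {k} * perm_sign {j} {l}) (gmon {i, j, k, l})"
proof -
  have "perm_sign {i, j} {k, l} = perm_sign {i} {k} * perm_sign {i} {l} * (perm_sign {j} {k} * (perm_sign {j} {l} :: 'a))"
    using assms by (simp add: perm_sign_def)
  moreover have "{i, j} \<union> {k, l} = {i, j, k, l}" by auto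
  ultimately show ?thesis
    using assms by (simp add: gpair_def gmon_mult_disjoint gscale_times_right gscale_gscale mult_ac flip: gscale_times)
qed

lemma gpair_mult_meet: "{i, j} \<inter> {k, l} \<noteq> {} \<Longrightarrow> gpair i j * gpair k l = 0"
  by (auto simp: gpair_def gmon_mult_meet gscale_times_right simp flip: gscale_times)

lemma perm_sign_anti: "i \<noteq> j \<Longrightarrow> perm_sign {i} {j} = - perm_sign {j} {i}"
  by (auto simp: perm_sign_def)

lemma gscale_minus: "gscale (- c) x = - gscale c x"
  by (rule grass_eqI) simp

lemma exchange_form_gpair: "exchange_form gpair"
proof
  fix i j k l :: nat
  show "gpair i j = (- gpair j i :: 'a grass)"
    using perm_sign_anti[of i j, where 'a = 'a] by (auto simp: gpair_def gscale_minus insert_commute)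
  show "gpair i j * gpair k l = - (gpair i k * gpair j l :: 'a grass)"
  proof (cases "distinct [i, j, k, l]")
    case True
    \<comment> \<open>Of the six signs in \<open>gpair_mult\<close>, exchanging \<open>j\<close> and
      \<open>k\<close> reverses only the one belonging to this pair.\<close>
    then have "distinct [i, k, j, l]" by auto
    have "{i, k, j, l} = {i, j, k, l}" by auto
    then show ?thesis
      using True by (simp add: gpair_mult[OF True] gpair_mult[OF \<open>distinct [i, k, j, l]\<close>] 
          perm_sign_anti[of k j] gscale_minus mult_ac)
  next
    case False
    \<comment> \<open>Any coincidence of indices makes both sides zero.\<close>
    then consider "i = j \<or> k = l" | "i = k \<or> j = l" | "i = l" | "j = k" by auto
    then show ?thesis
      by cases (auto simp: gpair_mult_meet, auto simp: gpair_def)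
  qed
qed (simp_all add: gpair_mult_meet, simp add: gpair_def)

section \<open>The filtration by degree in the low variables\<close>

definition low_degree_ge :: "nat \<Rightarrow> nat \<Rightarrow> 'f::comm_ring_1 grass \<Rightarrow> bool"
  where "low_degree_ge n d x \<longleftrightarrow> (\<forall>P. coef x P \<noteq> 0 \<longrightarrow> d \<le> card (P \<inter> {..<n}))"

lemma low_degree_ge_0 [simp]: "low_degree_ge n 0 x"
  by (simp add: low_degree_ge_def)

lemma low_degree_ge_zero [simp]: "low_degree_ge n d 0"
  by (simp add: low_degree_ge_def)

lemma low_degree_ge_add: "low_degree_ge n d x \<Longrightarrow> low_degree_ge n d y \<Longrightarrow> low_degree_ge n d (x + y)"
  by (auto simp: low_degree_ge_def) (metis add.right_neutral)

text \<open>A monomial of the product is a disjoint union of monomials of the two factors, so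
  degrees add.\<close>

lemma low_degree_ge_mult:
  assumes "low_degree_ge n d x" "low_degree_ge n e y"
  shows "low_degree_ge n (d + e) (x * y)"
  unfolding low_degree_ge_def
proof (intro allI impI)
  fix P assume "coef (x * y) P \<noteq> 0"
  then have "\<exists>T\<in>Pow P. perm_sign T (P - T) * coef x T * coef y (P - T) \<noteq> 0"
    unfolding coef_times conv_def by (meson sum.neutral)
  then obtain T where T: "T \<subseteq> P" "coef x T \<noteq> 0" "coef y (P - T) \<noteq> 0"
    by (auto dest!: mult_not_zero)
  then have "d + e \<le> card (T \<inter> {..<n}) + card ((P - T) \<inter> {..<n})"
    using assms by (simp add: low_degree_ge_def add_mono)
  also have "\<dots> = card ((T \<inter> {..<n}) \<union> ((P - T) \<inter> {..<n}))"
    by (rule card_Un_disjoint[symmetric]) auto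
  also have "(T \<inter> {..<n}) \<union> ((P - T) \<inter> {..<n}) = P \<inter> {..<n}" using T(1) by auto
  finally show "d + e \<le> card (P \<inter> {..<n})" .
qed

lemma low_degree_ge_mult_left: "low_degree_ge n d x \<Longrightarrow> low_degree_ge n d (x * y)"
  using low_degree_ge_mult[of n d x 0 y] by simp

lemma low_degree_ge_sum: "(\<And>i. i \<in> I \<Longrightarrow> low_degree_ge n d (f i)) \<Longrightarrow> low_degree_ge n d (sum f I)"
  by (induction I rule: infinite_finite_induct) (auto intro: low_degree_ge_add)

lemma low_degree_ge_gpair:
  assumes "i < n" "j < n"
  shows "low_degree_ge n 2 (gpair i j)"
proof (cases "i = j")
  case False
  then have "{i, j} \<inter> {..<n} = {i, j}" using assms by auto
  then show ?thesis
    using False by (auto simp: low_degree_ge_def gpair_def coef_gmon mono_at_def split: if_splits)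
qed (simp add: gpair_def)

lemma low_degree_ge_top:
  assumes "low_degree_ge n d x" "n < d"
  shows "x = 0"
proof (rule grass_eqI)
  fix P
  have "card (P \<inter> {..<n}) \<le> n" using card_mono[of "{..<n}" "P \<inter> {..<n}"] by simp
  then show "coef x P = coef 0 P" using assms by (force simp: low_degree_ge_def)
qed

section \<open>The twisted algebra of two forms\<close>

locale two_forms = X: exchange_form u + Y: exchange_form v
  for u v :: "nat \<Rightarrow> nat \<Rightarrow> 'r::comm_ring_1"
begin

definition twist :: "nat set \<Rightarrow> nat set \<Rightarrow> 'r"
  where "twist S T = X.ordered S T * Y.ordered S T"

text \<open>Commuting monomials past each other costs the factor \<open>1 + defect S T = (1 + X.W S T) (1 + Y.W S T)\<close>.\<close>

definition defect :: "nat set \<Rightarrow> nat set \<Rightarrow> 'r"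
  where "defect S T = X.W S T + Y.W S T + X.W S T * Y.W S T"

definition twisted_ring :: "(nat set \<Rightarrow> 'r) ring"
  where "twisted_ring = \<lparr>carrier = finsupp, mult = conv twist, one = mono_at 1 {},
    zero = (\<lambda>_. 0), add = (\<lambda>f g S. f S + g S)\<rparr>"

lemma twisted_ring_simps [simp]:
  "carrier twisted_ring = finsupp" "mult twisted_ring = conv twist"
  "one twisted_ring = mono_at 1 {}" "zero twisted_ring = (\<lambda>_. 0)"
  "add twisted_ring = (\<lambda>f g S. f S + g S)"
  by (simp_all add: twisted_ring_def)

sublocale twist: bicharacter twist
proof -
  interpret x: bicharacter X.ordered by (rule X.bicharacter_ordered)
  interpret y: bicharacter Y.ordered by (rule Y.bicharacter_ordered)
  show "bicharacter twist"
    by standard (simp_all add: twist_def x.union_left y.union_left x.union_right y.union_right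
        x.empty_left y.empty_left x.empty_right y.empty_right mult_ac)
qed

lemma twist_unit: "twist S T dvd 1"
  using mult_dvd_mono[OF X.ordered_unit Y.ordered_unit] by (simp add: twist_def)

lemma twist_swap:
  assumes "finite S" "finite T" "S \<inter> T = {}"
  shows "twist S T - twist T S = twist T S * defect S T"
proof -
  obtain n where "S \<union> T \<subseteq> {..<n}"
    using assms finite_nat_set_iff_bounded[of "S \<union> T"] by auto
  then have "X.ordered S T = X.ordered T S * (1 + X.W S T)" "Y.ordered S T = Y.ordered T S * (1 + Y.W S T)"
    using assms by (auto intro!: X.ordered_swap Y.ordered_swap)
  then show ?thesis by (simp add: twist_def defect_def algebra_simps)
qed

section \<open>Ring structure and commutators of the twisted algebra\<close>

lemma ring_twisted_ring: "ring twisted_ring"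
proof (rule ringI)
  show "abelian_group twisted_ring"
  proof (rule abelian_groupI)
    fix x :: "nat set \<Rightarrow> 'r" assume "x \<in> carrier twisted_ring"
    then show "\<exists>y\<in>carrier twisted_ring. y \<oplus>\<^bsub>twisted_ring\<^esub> x = \<zero>\<^bsub>twisted_ring\<^esub>"
      by (intro bexI[of _ "\<lambda>S. - x S"]) (auto simp: finsupp_def)
  qed (auto simp: finsupp_def add_ac)
  show "monoid twisted_ring"
    by (rule monoidI) (simp_all add: twist.conv_assoc twist.conv_one_left twist.conv_one_right)
qed (auto simp: conv_add_left conv_add_right)

sublocale A: ring twisted_ring
  by (rule ring_twisted_ring)

lemma minus_twisted_ring:
  assumes "f \<in> finsupp" "g \<in> finsupp"
  shows "f \<ominus>\<^bsub>twisted_ring\<^esub> g = (\<lambda>S. f S - g S)"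
proof -
  have "\<ominus>\<^bsub>twisted_ring\<^esub> g = (\<lambda>S. - g S)"
    using assms by (intro A.minus_equality) (auto simp: finsupp_def)
  then show ?thesis by (simp add: a_minus_def)
qed

text \<open>Reindexing the second product by complements matches the values of \<open>f\<close> and
  \<open>g\<close>, and the difference of the two twists becomes a defect.\<close>

lemma comm2_twisted_ring:
  assumes "f \<in> finsupp" "g \<in> finsupp"
  shows "comm2 twisted_ring f g S
    = (\<Sum>T\<in>Pow S. twist (S - T) T * defect T (S - T) * f T * g (S - T))"
proof (cases "finite S")
  case True
  have "comm2 twisted_ring f g S = conv twist f g S - conv twist g f S"
    by (simp add: comm2_def minus_twisted_ring)
  also have "\<dots> = (\<Sum>T\<in>Pow S. (twist T (S - T) - twist (S - T) T) * f T * g (S - T))"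
    by (simp add: conv_flip[of _ g f], simp add: conv_def algebra_simps sum_subtractf)
  also have "\<dots> = (\<Sum>T\<in>Pow S. twist (S - T) T * defect T (S - T) * f T * g (S - T))"
  proof (rule sum.cong)
    fix T assume "T \<in> Pow S"
    then have "finite T" using True by (auto intro: finite_subset)
    then have "twist T (S - T) - twist (S - T) T = twist (S - T) T * defect T (S - T)"
      using True by (intro twist_swap) auto
    then show "(twist T (S - T) - twist (S - T) T) * f T * g (S - T)
        = twist (S - T) T * defect T (S - T) * f T * g (S - T)" by simp
  qed simp
  finally show ?thesis .
next
  case False
  then show ?thesis by (simp add: comm2_def minus_twisted_ring conv_infinite)
qed

lemma comm2_closed: "f \<in> finsupp \<Longrightarrow> g \<in> finsupp \<Longrightarrow> comm2 twisted_ring f g \<in> finsupp"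
  by (rule finsuppI) (simp add: comm2_twisted_ring)

lemma comm2_mono_at:
  assumes "finite S" "finite T" "S \<inter> T = {}"
  shows "comm2 twisted_ring (mono_at c S) (mono_at d T) = mono_at (twist T S * defect S T * c * d) (S \<union> T)"
proof -
  have "T \<inter> S = {}" using assms(3) by auto
  then have "comm2 twisted_ring (mono_at c S) (mono_at d T)
      = mono_at ((twist S T - twist T S) * c * d) (S \<union> T)"
    using assms by (auto simp: comm2_def minus_twisted_ring conv_mono_at_disjoint mono_at_def algebra_simps Un_commute)
  then show ?thesis using assms by (simp add: twist_swap)
qed

end

section \<open>Lie nilpotency by counting factors in a filtration\<close>

lemma lcomm_snoc: "us \<noteq> [] \<Longrightarrow> lcomm A (us @ [x]) = comm2 A (lcomm A us) x"
  by (cases us) simp_all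

text \<open>Each \<open>J n\<close> behaves as an ideal, and multiplication by a value of
  \<open>Y.W\<close> climbs one level, so \<open>J\<close> counts the factors coming from
  \<open>Y.W\<close>.\<close>

locale two_forms_filtered = two_forms +
  fixes J :: "nat \<Rightarrow> 'a \<Rightarrow> bool"
  assumes J_0: "J 0 x"
    and J_add: "J n x \<Longrightarrow> J n y \<Longrightarrow> J n (x + y)"
    and J_zero: "J n 0"
    and J_mult: "J n x \<Longrightarrow> J n (x * y)"
    and J_step: "J n x \<Longrightarrow> J (Suc n) (x * Y.W S T)"
begin

text \<open>Coefficients of an \<open>n\<close>-fold commutator at \<open>S\<close>. In the expansion of the product of the defects
  along a commutator the forms \<open>X.W\<close> and \<open>Y.W\<close> must alternate; the summand annihilated by
  \<open>X.W S _\<close> is the part whose last factor came from \<open>X.W\<close>, and similarly for \<open>Y\<close>.\<close>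

definition alternating :: "nat \<Rightarrow> nat set \<Rightarrow> 'a \<Rightarrow> bool"
  where "alternating n S c \<longleftrightarrow> (\<exists>p q. c = p + q
     \<and> (\<forall>U. p * X.W S U = 0) \<and> J ((n - 1) div 2) p
     \<and> (\<forall>U. q * Y.W S U = 0) \<and> J (n div 2) q)"

lemma alternating_add:
  assumes "alternating n S c" "alternating n S d"
  shows "alternating n S (c + d)"
proof -
  obtain p q where 1: "c = p + q" "\<forall>U. p * X.W S U = 0" "J ((n - 1) div 2) p"
      "\<forall>U. q * Y.W S U = 0" "J (n div 2) q"
    using assms(1) unfolding alternating_def by blast
  obtain p' q' where 2: "d = p' + q'" "\<forall>U. p' * X.W S U = 0" "J ((n - 1) div 2) p'"
      "\<forall>U. q' * Y.W S U = 0" "J (n div 2) q'"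
    using assms(2) unfolding alternating_def by blast
  show ?thesis
    unfolding alternating_def
    by (rule exI[of _ "p + p'"], rule exI[of _ "q + q'"]) (use 1 2 in \<open>simp add: distrib_right J_add\<close>)
qed

lemma alternating_mult:
  assumes "alternating n S c"
  shows "alternating n S (c * d)"
proof -
  obtain p q where 1: "c = p + q" "\<forall>U. p * X.W S U = 0" "J ((n - 1) div 2) p"
      "\<forall>U. q * Y.W S U = 0" "J (n div 2) q"
    using assms(1) unfolding alternating_def by blast
  have "p * d * X.W S U = 0" "q * d * Y.W S U = 0" for U
    using 1 by (metis mult.commute mult.left_commute mult_zero_right)+
  then show ?thesis
    unfolding alternating_def
    by (intro exI[of _ "p * d"] exI[of _ "q * d"]) (use 1 in \<open>simp add: distrib_right J_mult\<close>)
qed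

lemma alternating_zero: "alternating n S 0"
  unfolding alternating_def by (intro exI[of _ 0]) (simp add: J_zero)

lemma alternating_sum: "(\<And>i. i \<in> I \<Longrightarrow> alternating n S (f i)) \<Longrightarrow> alternating n S (sum f I)"
  by (induction I rule: infinite_finite_induct) (auto intro: alternating_add alternating_zero)

text \<open>Length two means a single defect. Its mixed term joins the part killed by
  \<open>X.W\<close>, which has to reach only level 0; \<open>Y.W\<close> alone forms the other
  part, of level 1.\<close>

lemma alternating_base:
  assumes "finite S" "T \<subseteq> S"
  shows "alternating 2 S (defect T (S - T))"
proof -
  let ?x = "X.W T S" and ?y = "Y.W T S"
  have d: "X.W T (S - T) = ?x" "Y.W T (S - T) = ?y"
    using assms X.W_diff Y.W_diff by auto
  have "?x * X.W S U = 0" "?y * Y.W S U = 0" for U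
    using assms(1) X.W_chain Y.W_chain by auto
  moreover from this have "(?x + ?x * ?y) * X.W S U = 0" for U
    by (simp add: distrib_right) (metis mult.commute mult.left_commute mult_zero_right)
  moreover have "J 1 ?y" using J_step[OF J_0, of 1 T S] by simp
  ultimately show ?thesis
    unfolding alternating_def defect_def d
    by (intro exI[of _ "?x + ?x * ?y"] exI[of _ ?y]) (simp add: J_0 algebra_simps)
qed

text \<open>The part killed by \<open>X.W\<close> survives only through \<open>Y.W\<close> and
  conversely, and the mixed term dies on both. By \<open>W_chain\<close> the two parts then exchange
  roles.\<close>

lemma alternating_step:
  assumes "alternating n T c" "finite S" "T \<subseteq> S" "n > 0"
  shows "alternating (Suc n) S (defect T (S - T) * c)"
proof -
  obtain p q where 1: "c = p + q" "\<forall>U. p * X.W T U = 0" "J ((n - 1) div 2) p"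
      "\<forall>U. q * Y.W T U = 0" "J (n div 2) q"
    using assms(1) unfolding alternating_def by blast
  let ?x = "X.W T S" and ?y = "Y.W T S"
  have d: "X.W T (S - T) = ?x" "Y.W T (S - T) = ?y"
    using assms X.W_diff Y.W_diff by auto
  have "?x * X.W S U = 0" "?y * Y.W S U = 0" for U
    using assms(2) X.W_chain Y.W_chain by auto
  then have "q * ?x * X.W S U = 0" "p * ?y * Y.W S U = 0" for U
    by (simp_all add: mult.assoc)
  moreover have "defect T (S - T) * c = q * ?x + p * ?y"
  proof -
    have "defect T (S - T) * c = p * ?x + p * ?y + (p * ?x) * ?y + q * ?x + q * ?y + (q * ?y) * ?x"
      by (simp add: defect_def d 1(1) algebra_simps)
    then show ?thesis using 1 by simp
  qed
  moreover have "J (Suc n div 2) (p * ?y)"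
  proof -
    \<comment> \<open>The old \<open>p\<close> supplies the new \<open>q\<close>, one level
      higher.\<close>
    have "Suc ((n - 1) div 2) = Suc n div 2" using \<open>n > 0\<close> by (cases n) auto
    then show ?thesis using J_step[OF 1(3)] by metis
  qed
  moreover have "J ((Suc n - 1) div 2) (q * ?x)" using 1 by (simp add: J_mult)
  ultimately show ?thesis unfolding alternating_def by blast
qed

text \<open>The coefficient at \<open>S\<close> collects, over the subsets \<open>T\<close>,
  multiples of the previous coefficient at \<open>T\<close> times the defect of \<open>T\<close> and
  \<open>S - T\<close>.\<close>

lemma alternating_lcomm:
  assumes "length us = n" "n \<ge> 2" "set us \<subseteq> finsupp"
  shows "lcomm twisted_ring us \<in> finsupp \<and> (\<forall>S. finite S \<longrightarrow> alternating n S (lcomm twisted_ring us S))"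
  using assms(2,1,3)
proof (induction n arbitrary: us rule: dec_induct)
  case base
  then obtain f g where us: "us = [f, g]" "f \<in> finsupp" "g \<in> finsupp"
    by (auto simp: numeral_2_eq_2 length_Suc_conv)
  have "alternating 2 S (comm2 twisted_ring f g S)" if "finite S" for S
  proof -
    have "alternating 2 S (defect T (S - T) * (twist (S - T) T * f T * g (S - T)))" if "T \<in> Pow S" for T
      using \<open>finite S\<close> that by (auto intro: alternating_mult alternating_base)
    then show ?thesis
      unfolding comm2_twisted_ring[OF us(2,3)] by (intro alternating_sum) (simp add: mult_ac)
  qed
  then show ?case using us by (simp add: comm2_closed)
next
  case (step n)
  then obtain vs g where us: "us = vs @ [g]" "length vs = n"
    by (metis length_Suc_conv_rev)
  then have IH: "lcomm twisted_ring vs \<in> finsupp" "\<And>S. finite S \<Longrightarrow> alternating n S (lcomm twisted_ring vs S)"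
    and g: "g \<in> finsupp" using step by auto
  let ?f = "lcomm twisted_ring vs"
  have "alternating (Suc n) S (comm2 twisted_ring ?f g S)" if "finite S" for S
  proof -
    have "alternating (Suc n) S (defect T (S - T) * ?f T * (twist (S - T) T * g (S - T)))" if "T \<in> Pow S" for T
    proof (rule alternating_mult[OF alternating_step])
      show "alternating n T (?f T)" using that \<open>finite S\<close> by (auto intro: IH finite_subset)
    qed (use that \<open>finite S\<close> step in auto)
    then show ?thesis
      unfolding comm2_twisted_ring[OF IH(1) g] by (intro alternating_sum) (simp add: mult_ac)
  qed
  moreover have "vs \<noteq> []" using us step by auto
  ultimately show ?case using us IH g by (simp add: lcomm_snoc comm2_closed)
qed

theorem lie_nilpotent:
  assumes "\<And>x. J (Suc s) x \<Longrightarrow> x = 0"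
    and "length us = 2 * s + 3" "set us \<subseteq> finsupp"
  shows "lcomm twisted_ring us = (\<lambda>_. 0)"
proof
  fix S
  have *: "lcomm twisted_ring us \<in> finsupp \<and> (\<forall>S. finite S \<longrightarrow> alternating (2 * s + 3) S (lcomm twisted_ring us S))"
    using assms by (intro alternating_lcomm) auto
  show "lcomm twisted_ring us S = 0"
  proof (cases "finite S")
    case True
    \<comment> \<open>At this odd length both parts have reached level \<open>Suc s\<close>, where
      everything is zero.\<close>
    have "(2 * s + 3 - 1) div 2 = Suc s" "(2 * s + 3) div 2 = Suc s" by auto
    with True * show ?thesis
      using assms(1) unfolding alternating_def by (metis add.right_neutral)
  next
    case False
    then show ?thesis using * finsuppD by blast
  qed
qed

end

section \<open>Nonvanishing products of commutators\<close>

abbreviation high_pair :: "nat \<Rightarrow> nat \<Rightarrow> nat \<Rightarrow> 'f::comm_ring_1 grass"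
  where "high_pair n i j \<equiv> if n \<le> i \<and> n \<le> j then gpair i j else 0"

abbreviation low_pair :: "nat \<Rightarrow> nat \<Rightarrow> nat \<Rightarrow> 'f::comm_ring_1 grass"
  where "low_pair n i j \<equiv> if i < n \<and> j < n then gpair i j else 0"

text \<open>Every term of the low form contains two low variables, so one level of the filtration is
  two degrees.\<close>

lemma two_forms_filtered_grass:
  fixes s :: nat
  shows "two_forms_filtered (high_pair (2 * s) :: nat \<Rightarrow> nat \<Rightarrow> 'f::comm_ring_1 grass) (low_pair (2 * s))
    (\<lambda>d. low_degree_ge (2 * s) (2 * d))"
proof -
  interpret X: exchange_form "high_pair (2 * s) :: nat \<Rightarrow> nat \<Rightarrow> 'f grass"
    by (rule exchange_form_restrict[OF exchange_form_gpair])
  interpret Y: exchange_form "low_pair (2 * s) :: nat \<Rightarrow> nat \<Rightarrow> 'f grass"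
    by (rule exchange_form_restrict[OF exchange_form_gpair])
  have W: "low_degree_ge (2 * s) 2 (Y.W S T)" for S T
    unfolding Y.W_def by (auto intro!: low_degree_ge_sum simp: low_degree_ge_gpair)
  have "low_degree_ge (2 * s) (2 * Suc n) (x * Y.W S T)" if "low_degree_ge (2 * s) (2 * n) x" for n S T x
    using low_degree_ge_mult[OF that W, of S T] by simp
  then show ?thesis
    by unfold_locales (simp_all add: low_degree_ge_add low_degree_ge_mult_left)
qed

interpretation G: two_forms_filtered "high_pair (2 * s)" "low_pair (2 * s)"
    "\<lambda>d. low_degree_ge (2 * s) (2 * d)" for s
  by (rule two_forms_filtered_grass)

section \<open>Coefficients that are units times Grassmann monomials\<close>

definition unit_gmon :: "nat set \<Rightarrow> 'f::comm_ring_1 grass \<Rightarrow> bool"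
  where "unit_gmon P c \<longleftrightarrow> finite P \<and> even (card P) \<and> (\<exists>e. e dvd 1 \<and> c = e * gmon P)"

lemma unit_gmon_nonzero:
  fixes c :: "'f::comm_ring_1 grass"
  assumes "unit_gmon P c"
  shows "c \<noteq> 0"
proof
  obtain e where e: "e dvd 1" "c = e * gmon P" "finite P" "even (card P)"
    using assms by (auto simp: unit_gmon_def)
  then obtain e' where e': "1 = e * e'" by (auto elim: dvdE)
  assume "c = 0"
  have "gmon P = (e * e') * gmon P" unfolding e'[symmetric] by simp
  also have "\<dots> = e' * c" unfolding e(2) by (simp only: mult_ac)
  finally have "gmon P = (0 :: 'f grass)" using \<open>c = 0\<close> by simp
  then show False using e gmon_nonzero by blast
qed

text \<open>Units absorb the twists and signs created by products and commutators, so that only the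
  set of variables has to be tracked.\<close>

lemma unit_gmon_unit_mult:
  assumes "d dvd 1" "unit_gmon P c"
  shows "unit_gmon P (d * c)"
proof -
  obtain e where e: "e dvd 1" "c = e * gmon P" "finite P" "even (card P)"
    using assms by (auto simp: unit_gmon_def)
  have "d * e dvd 1" using mult_dvd_mono[OF assms(1) e(1)] by simp
  then show ?thesis using e by (auto simp: unit_gmon_def mult.assoc)
qed

lemma gscale_sign_unit: "gscale (perm_sign A B) 1 dvd (1 :: 'f::comm_ring_1 grass)"
proof
  show "1 = gscale (perm_sign A B) 1 * (gscale (perm_sign A B) 1 :: 'f grass)"
    by (rule grass_eqI) (simp add: gscale_times_right gscale_gscale perm_sign_square)
qed

lemma gscale_conv_times: "gscale c x = gscale c 1 * x"
  by (simp flip: gscale_times)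

lemma unit_gmon_mult:
  assumes "unit_gmon P c" "unit_gmon Q d" "P \<inter> Q = {}"
  shows "unit_gmon (P \<union> Q) (c * d)"
proof -
  obtain e e' where e: "e dvd 1" "c = e * gmon P" "e' dvd 1" "d = e' * gmon Q"
    and P: "finite P" "even (card P)" "finite Q" "even (card Q)"
    using assms by (auto simp: unit_gmon_def)
  have "gmon P * gmon Q = gscale (perm_sign P Q) 1 * (gmon (P \<union> Q) :: 'a grass)"
    using P assms(3) by (simp add: gmon_mult_disjoint gscale_conv_times[of _ "gmon (P \<union> Q)"])
  then have "c * d = (e * e' * gscale (perm_sign P Q) 1) * gmon (P \<union> Q)"
    using e by (simp add: mult_ac)
  moreover have "e * e' * gscale (perm_sign P Q) 1 dvd 1"
    using mult_dvd_mono[OF mult_dvd_mono[OF e(1,3)] gscale_sign_unit[of P Q]] by simp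
  moreover have "even (card (P \<union> Q))" using P assms(3) by (simp add: card_Un_disjoint)
  ultimately show ?thesis using P unfolding unit_gmon_def by blast
qed

lemma unit_gmon_gpair: "i \<noteq> j \<Longrightarrow> unit_gmon {i, j} (gpair i j)"
  unfolding unit_gmon_def gpair_def
  by (auto intro!: exI[of _ "gscale (perm_sign {i} {j}) 1"] gscale_sign_unit gscale_conv_times)

lemma unit_gmon_one: "unit_gmon {} 1"
proof -
  have "gmon {} = (1 :: 'a grass)" by transfer (simp add: fun_eq_iff)
  then show ?thesis by (auto simp: unit_gmon_def)
qed

lemma unit_gmon_gpair_meet:
  fixes c :: "'f::comm_ring_1 grass"
  assumes "unit_gmon P c" "i \<in> P \<or> j \<in> P"
  shows "c * gpair i j = 0"
proof (cases "i = j")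
  case False
  have "gmon P * gpair i j = (0 :: 'f grass)"
    using assms False by (auto simp: unit_gmon_def gpair_def gscale_times_right gmon_mult_meet)
  then show ?thesis using assms by (auto simp: unit_gmon_def mult.assoc)
qed (simp add: gpair_def)

text \<open>Multiplication by \<open>c\<close> kills every pair that meets \<open>P\<close>, and the
  last assumption leaves at most the pair of \<open>z\<close> and \<open>z'\<close> among the
  others.\<close>

lemma unit_gmon_form:
  assumes "unit_gmon P c" "finite S" "finite T" "z \<in> S" "z' \<in> T"
    and "\<And>i j. i \<in> S - P \<Longrightarrow> j \<in> T \<Longrightarrow> Q i \<Longrightarrow> Q j \<Longrightarrow> i = z \<and> j = z'"
  shows "c * (\<Sum>i\<in>S. \<Sum>j\<in>T. if Q i \<and> Q j then gpair i j else 0)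
    = (if Q z \<and> Q z' then c * gpair z z' else 0)"
proof -
  have "c * (\<Sum>i\<in>S. \<Sum>j\<in>T. if Q i \<and> Q j then gpair i j else 0)
      = (\<Sum>i\<in>S. \<Sum>j\<in>T. if Q i \<and> Q j then c * gpair i j else 0)"
    by (simp add: sum_distrib_left if_distrib cong: if_cong)
  also have "\<dots> = (\<Sum>i\<in>S. \<Sum>j\<in>T. if i = z \<and> j = z' then (if Q z \<and> Q z' then c * gpair z z' else 0) else 0)"
  proof (intro sum.cong refl)
    fix i j assume "i \<in> S" "j \<in> T"
    then show "(if Q i \<and> Q j then c * gpair i j else 0)
        = (if i = z \<and> j = z' then (if Q z \<and> Q z' then c * gpair z z' else 0) else 0)"
      using assms(6)[of i j] unit_gmon_gpair_meet[OF assms(1), of i j] by auto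
  qed
  also have "\<dots> = (\<Sum>i\<in>S. if i = z then \<Sum>j\<in>T. if j = z' then (if Q z \<and> Q z' then c * gpair z z' else 0) else 0 else 0)"
    by (intro sum.cong refl) auto
  also have "\<dots> = (if Q z \<and> Q z' then c * gpair z z' else 0)"
    using assms(2-5) by simp
  finally show ?thesis .
qed

text \<open>Exactly one pair on a common side of the bound survives. So one form multiplies
  \<open>c\<close> by a single \<open>gpair\<close>, while the product of \<open>c\<close> with the
  other form, and hence the mixed term, is zero.\<close>

lemma unit_gmon_defect:
  assumes "unit_gmon P c" "finite S" "finite T" "S \<inter> T = {}" "P \<subseteq> S" "z \<in> S - P" "z' \<in> T"
    and same: "z < 2 * s \<longleftrightarrow> z' < 2 * s"
    and uniq: "\<And>i j. i \<in> S - P \<Longrightarrow> j \<in> T \<Longrightarrow> (i < 2 * s \<longleftrightarrow> j < 2 * s) \<Longrightarrow> i = z \<and> j = z'"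
  shows "unit_gmon (P \<union> {z, z'}) (G.defect s S T * c)"
proof -
  have "c * G.X.W s S T = (if 2 * s \<le> z \<and> 2 * s \<le> z' then c * gpair z z' else 0)"
    unfolding G.X.W_def
  proof (rule unit_gmon_form[OF assms(1-3)])
    fix i j assume "i \<in> S - P" "j \<in> T" "2 * s \<le> i" "2 * s \<le> j"
    then show "i = z \<and> j = z'" by (intro uniq) auto
  qed (use assms(6,7) in auto)
  then have X: "c * G.X.W s S T = (if 2 * s \<le> z then c * gpair z z' else 0)"
    using same by (simp flip: not_less)
  have "c * G.Y.W s S T = (if z < 2 * s \<and> z' < 2 * s then c * gpair z z' else 0)"
    unfolding G.Y.W_def
  proof (rule unit_gmon_form[OF assms(1-3)])
    fix i j assume "i \<in> S - P" "j \<in> T" "i < 2 * s" "j < 2 * s"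
    then show "i = z \<and> j = z'" by (intro uniq) auto
  qed (use assms(6,7) in auto)
  then have Y: "c * G.Y.W s S T = (if z < 2 * s then c * gpair z z' else 0)"
    using same by simp
  have eq: "c * (G.X.W s S T * G.Y.W s S T) = c * G.X.W s S T * G.Y.W s S T"
    "c * (G.X.W s S T * G.Y.W s S T) = c * G.Y.W s S T * G.X.W s S T"
    by (simp_all only: mult_ac)
  have prod: "c * (G.X.W s S T * G.Y.W s S T) = 0"
  proof (cases "z < 2 * s")
    case True
    then have "c * G.X.W s S T = 0" using X by simp
    then show ?thesis unfolding eq(1) by (simp only: mult_zero_left)
  next
    case False
    then have "c * G.Y.W s S T = 0" using Y by simp
    then show ?thesis unfolding eq(2) by (simp only: mult_zero_left)
  qed
  have "G.defect s S T * c = c * G.X.W s S T + c * G.Y.W s S T + c * (G.X.W s S T * G.Y.W s S T)"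
    unfolding G.defect_def by (simp only: algebra_simps)
  then have "G.defect s S T * c = c * gpair z z'"
    unfolding prod X Y by (simp add: not_less)
  moreover have "unit_gmon (P \<union> {z, z'}) (c * gpair z z')"
    using assms(4-7) by (intro unit_gmon_mult[OF assms(1)] unit_gmon_gpair) auto
  ultimately show ?thesis by simp
qed

text \<open>The \<open>j\<close>-th entry of a commutator: it carries the high variable \<open>x + j\<close>, and the low variable
  \<open>y\<close> (for \<open>j = 0\<close>) or \<open>y + j - 1\<close> (for \<open>j \<ge> 2\<close>) as long as the \<open>r\<close> available low variables last.\<close>

definition entry :: "nat \<Rightarrow> nat \<Rightarrow> nat \<Rightarrow> nat \<Rightarrow> nat set"
  where "entry x y r j = insert (x + j) (if j \<noteq> 1 \<and> j - 1 < r then {y + (j - 1)} else {})"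

lemma finite_entry [simp]: "finite (entry x y r j)"
  by (simp add: entry_def)

text \<open>The variables of the first \<open>n\<close> entries that are not yet absorbed into the
  coefficient. Pairings alternate between high and low, so beyond the first entry at most one is
  left over.\<close>

definition unpaired :: "nat \<Rightarrow> nat \<Rightarrow> nat \<Rightarrow> nat \<Rightarrow> nat set"
  where "unpaired x y r n = (if n = 1 then entry x y r 0
    else if even n then (if n - 2 < r then {y + (n - 2)} else {}) else {x + (n - 1)})"

text \<open>The low block ends below the high one. By truncated subtraction index 0 receives
  \<open>y\<close>; index 1 would receive it again, and \<open>entry\<close> excludes it.\<close>

lemma entry_fresh:
  assumes "n > 0" "y + r \<le> x"
  shows "(\<Union>j<n. entry x y r j) \<inter> entry x y r n = {}"
proof -
  have "i \<notin> entry x y r n" if "j < n" "i \<in> entry x y r j" for i j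
    using that assms by (cases "j \<noteq> 1 \<and> j - 1 < r"; cases "n \<noteq> 1 \<and> n - 1 < r") (auto simp: entry_def)
  then show ?thesis by auto
qed

text \<open>Induction on the prefix: each new entry admits exactly one pairing with a waiting
  variable on its side of the bound, so \<open>unit_gmon_defect\<close> applies.\<close>

lemma lcomm_entries:
  fixes m s x y :: nat
  defines "r \<equiv> 2 * ((m - 1) div 2)"
  assumes "y + r \<le> 2 * s" "2 * s \<le> x" "0 < n" "n \<le> m"
  shows "\<exists>P c. lcomm (G.twisted_ring s) (map (\<lambda>j. mono_at 1 (entry x y r j)) [0..<n])
        = mono_at (c :: 'f::comm_ring_1 grass) (\<Union>j<n. entry x y r j)
      \<and> unit_gmon P c \<and> P \<subseteq> (\<Union>j<n. entry x y r j)
      \<and> (\<Union>j<n. entry x y r j) - P = unpaired x y r n"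
  using assms(4,5)
proof (induction n)
  case (Suc n)
  let ?A = "G.twisted_ring s :: (nat set \<Rightarrow> 'f grass) ring"
  let ?S = "\<Union>j<n. entry x y r j" and ?T = "entry x y r n"
  show ?case
  proof (cases "n = 0")
    case True
    then have "(\<Union>j<Suc n. entry x y r j) = entry x y r 0" by auto
    then show ?thesis
      using True by (intro exI[of _ "{}"] exI[of _ 1]) (simp add: unpaired_def unit_gmon_one)
  next
    case False
    then obtain P c where IH: "lcomm ?A (map (\<lambda>j. mono_at 1 (entry x y r j)) [0..<n]) = mono_at c ?S"
      "unit_gmon P c" "P \<subseteq> ?S" "?S - P = unpaired x y r n"
      using Suc by auto
    have disj: "?S \<inter> ?T = {}" using entry_fresh False assms(2,3) by simp
    have US: "(\<Union>j<Suc n. entry x y r j) = ?S \<union> ?T" by (auto simp: lessThan_Suc)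
    let ?d = "G.twist s ?T ?S * G.defect s ?S ?T * c * 1"
    have comm: "lcomm ?A (map (\<lambda>j. mono_at 1 (entry x y r j)) [0..<Suc n]) = mono_at ?d (?S \<union> ?T)"
      using False disj by (simp add: lcomm_snoc IH(1) G.comm2_mono_at)
    \<comment> \<open>The common step: it remains to name the pair \<open>z\<close>,
      \<open>z'\<close> and to check what stays unpaired.\<close>
    have fin: "\<exists>P c. lcomm ?A (map (\<lambda>j. mono_at 1 (entry x y r j)) [0..<Suc n])
        = mono_at c (?S \<union> ?T) \<and> unit_gmon P c \<and> P \<subseteq> ?S \<union> ?T
        \<and> ?S \<union> ?T - P = unpaired x y r (Suc n)"
      if z: "z \<in> unpaired x y r n" "z' \<in> ?T" "z < 2 * s \<longleftrightarrow> z' < 2 * s"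
        "\<And>i j. i \<in> unpaired x y r n \<Longrightarrow> j \<in> ?T \<Longrightarrow> (i < 2 * s \<longleftrightarrow> j < 2 * s) \<Longrightarrow> i = z \<and> j = z'"
        and open': "unpaired x y r n \<union> ?T - {z, z'} = unpaired x y r (Suc n)" for z z'
    proof (intro exI conjI)
      have "unit_gmon (P \<union> {z, z'}) (G.defect s ?S ?T * c)"
        by (rule unit_gmon_defect[OF IH(2) _ _ disj IH(3) z(1-4)[folded IH(4)]]) auto
      then show "unit_gmon (P \<union> {z, z'}) ?d"
        using unit_gmon_unit_mult[OF G.twist_unit[of s ?T ?S]] by (simp add: mult.assoc)
      show "P \<union> {z, z'} \<subseteq> ?S \<union> ?T" using z(1,2) IH(3,4) by blast
      have "?S \<union> ?T - (P \<union> {z, z'}) = ((?S - P) \<union> ?T) - {z, z'}"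
        using disj IH(3) by auto
      then show "?S \<union> ?T - (P \<union> {z, z'}) = unpaired x y r (Suc n)"
        using open' IH(4) by simp
    qed (rule comm)
    have "n = 1 \<or> n \<ge> 2 \<and> even n \<or> n \<ge> 3 \<and> odd n"
      using False by presburger
    then consider "n = 1" | "n \<ge> 2" "even n" | "n \<ge> 3" "odd n" by blast
    then show ?thesis unfolding US
    proof cases
      case 1
      show "\<exists>P c. lcomm ?A (map (\<lambda>j. mono_at 1 (entry x y r j)) [0..<Suc n])
        = mono_at c (?S \<union> ?T) \<and> unit_gmon P c \<and> P \<subseteq> ?S \<union> ?T
        \<and> ?S \<union> ?T - P = unpaired x y r (Suc n)"
        \<comment> \<open>Entry 1 has no low variable, so a low variable of entry 0 has to
          wait.\<close>
        by (rule fin[of x "x + 1"])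
          (use 1 assms(2,3) in \<open>auto simp: unpaired_def entry_def split: if_splits\<close>)
    next
      case 2
      then obtain q where q: "n = 2 * q" "q \<ge> 1" by (auto elim: evenE)
      \<comment> \<open>An even \<open>n < m\<close> is at most \<open>r\<close>, so entry
        \<open>n\<close> does carry a low variable.\<close>
      have "q \<le> (m - 1) div 2" using Suc.prems q by linarith
      then have lt: "n - 1 < r" unfolding r_def using q by linarith
      have "unpaired x y r n = {y + (n - 2)}" "?T = {x + n, y + (n - 1)}" "unpaired x y r (Suc n) = {x + n}"
        using 2 lt by (auto simp: unpaired_def entry_def)
      then show "\<exists>P c. lcomm ?A (map (\<lambda>j. mono_at 1 (entry x y r j)) [0..<Suc n])
        = mono_at c (?S \<union> ?T) \<and> unit_gmon P c \<and> P \<subseteq> ?S \<union> ?T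
        \<and> ?S \<union> ?T - P = unpaired x y r (Suc n)"
        by (intro fin[of "y + (n - 2)" "y + (n - 1)"]) (use 2 lt assms(2,3) in auto)
    next
      case 3
      then have "unpaired x y r n = {x + (n - 1)}"
        "?T = insert (x + n) (if n - 1 < r then {y + (n - 1)} else {})"
        "unpaired x y r (Suc n) = (if n - 1 < r then {y + (n - 1)} else {})"
        by (auto simp: unpaired_def entry_def)
      then show "\<exists>P c. lcomm ?A (map (\<lambda>j. mono_at 1 (entry x y r j)) [0..<Suc n])
        = mono_at c (?S \<union> ?T) \<and> unit_gmon P c \<and> P \<subseteq> ?S \<union> ?T
        \<and> ?S \<union> ?T - P = unpaired x y r (Suc n)"
        \<comment> \<open>The high variables pair up; a new low variable, if there is one,
          waits.\<close>
        by (intro fin[of "x + (n - 1)" "x + n"]) (use 3 assms(2,3) in \<open>auto split: if_splits\<close>)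
    qed
  qed
qed simp

text \<open>Each factor gets its own block of \<open>m i\<close> high and \<open>r i\<close> low
  variables, the low blocks together filling the \<open>2 * s\<close> places. Disjoint monomials
  then multiply to a unit times a monomial.\<close>

lemma lcomm_products_nonzero:
  fixes k s :: nat and m :: "nat \<Rightarrow> nat"
  defines "r \<equiv> \<lambda>i. 2 * ((m i - 1) div 2)"
  assumes "\<forall>i<k. m i > 0" "(\<Sum>i<k. r i) = 2 * s" "n \<le> k"
  shows "\<exists>P S c. foldl (\<lambda>acc i. acc \<otimes>\<^bsub>G.twisted_ring s\<^esub> lcomm (G.twisted_ring s)
        (map (\<lambda>j. mono_at 1 (entry (2 * s + (\<Sum>i<i. m i)) (\<Sum>i<i. r i) (r i) j)) [0..<m i]))
        \<one>\<^bsub>G.twisted_ring s\<^esub> [0..<n] = mono_at (c :: 'f::comm_ring_1 grass) S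
    \<and> unit_gmon P c \<and> P \<subseteq> S \<and> S \<subseteq> {2 * s..<2 * s + (\<Sum>i<n. m i)} \<union> {..<\<Sum>i<n. r i}"
  using assms(4)
proof (induction n)
  case 0
  show ?case
    by (intro exI[of _ "{}"] exI[of _ 1]) (simp add: unit_gmon_one)
next
  case (Suc n)
  let ?A = "G.twisted_ring s :: (nat set \<Rightarrow> 'f grass) ring"
  let ?x = "2 * s + (\<Sum>i<n. m i)" and ?y = "\<Sum>i<n. r i"
  let ?S' = "\<Union>j<m n. entry ?x ?y (r n) j"
  obtain P S c where IH: "foldl (\<lambda>acc i. acc \<otimes>\<^bsub>?A\<^esub> lcomm ?A
        (map (\<lambda>j. mono_at 1 (entry (2 * s + (\<Sum>i<i. m i)) (\<Sum>i<i. r i) (r i) j)) [0..<m i]))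
        \<one>\<^bsub>?A\<^esub> [0..<n] = mono_at c S"
    "unit_gmon P c" "P \<subseteq> S" "S \<subseteq> {2 * s..<?x} \<union> {..<?y}"
    using Suc by auto
  have le: "?y + r n \<le> 2 * s"
  proof -
    have "(\<Sum>i<Suc n. r i) \<le> (\<Sum>i<k. r i)"
      using Suc.prems by (intro sum_mono2) auto
    then show ?thesis using assms(3) by simp
  qed
  obtain P' c' where new: "lcomm ?A (map (\<lambda>j. mono_at 1 (entry ?x ?y (r n) j)) [0..<m n]) = mono_at c' ?S'"
    "unit_gmon P' c'" "P' \<subseteq> ?S'"
    using lcomm_entries[of ?y "m n" s ?x "m n", where 'f = 'f] le assms(2) Suc.prems unfolding r_def by auto
  have sub: "?S' \<subseteq> {?x..<?x + m n} \<union> {?y..<?y + r n}"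
    by (auto simp: entry_def split: if_splits)
  have "finite S" using IH(4) finite_subset by blast
  have disj: "S \<inter> ?S' = {}"
  proof -
    have "({2 * s..<?x} \<union> {..<?y}) \<inter> ({?x..<?x + m n} \<union> {?y..<?y + r n}) = {}"
      using le by auto
    then show ?thesis using IH(4) sub by blast
  qed
  show ?case
  proof (intro exI conjI)
    show "foldl (\<lambda>acc i. acc \<otimes>\<^bsub>?A\<^esub> lcomm ?A
        (map (\<lambda>j. mono_at 1 (entry (2 * s + (\<Sum>i<i. m i)) (\<Sum>i<i. r i) (r i) j)) [0..<m i]))
        \<one>\<^bsub>?A\<^esub> [0..<Suc n] = mono_at (G.twist s S ?S' * c * c') (S \<union> ?S')"
      using IH(1) new(1) \<open>finite S\<close> disj by (simp add: conv_mono_at_disjoint)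
    have "unit_gmon (P \<union> P') (c * c')"
      using IH(2,3) new(2,3) disj by (intro unit_gmon_mult) auto
    then show "unit_gmon (P \<union> P') (G.twist s S ?S' * c * c')"
      unfolding mult.assoc by (rule unit_gmon_unit_mult[OF G.twist_unit])
    show "P \<union> P' \<subseteq> S \<union> ?S'" using IH(3) new(3) by blast
    show "S \<union> ?S' \<subseteq> {2 * s..<2 * s + (\<Sum>i<Suc n. m i)} \<union> {..<\<Sum>i<Suc n. r i}"
    proof -
      have "{2 * s..<?x} \<union> {..<?y} \<union> ({?x..<?x + m n} \<union> {?y..<?y + r n})
          \<subseteq> {2 * s..<2 * s + (\<Sum>i<Suc n. m i)} \<union> {..<\<Sum>i<Suc n. r i}"
        by auto
      then show ?thesis using IH(4) sub by blast
    qed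
  qed
qed

section \<open>Transport to functions on lists\<close>

text \<open>Position 1 codes the outer index set and position 0 the Grassmann monomial. Codes reach
  only finite sets, but elsewhere the functions in \<open>finsupp\<close> and their coefficients
  vanish, so nothing is lost.\<close>

definition encode :: "(nat set \<Rightarrow> 'f::comm_ring_1 grass) \<Rightarrow> nat list \<Rightarrow> 'f"
  where "encode f xs = (if length xs = 2 then coef (f (set_decode (xs ! 1))) (set_decode (xs ! 0)) else 0)"

lemma inj_on_encode: "inj_on encode finsupp"
proof (rule inj_onI, rule ext, rule grass_eqI)
  fix f g :: "nat set \<Rightarrow> 'f::comm_ring_1 grass" and S P
  assume f: "f \<in> finsupp" and g: "g \<in> finsupp" and eq: "encode f = encode g"
  show "coef (f S) P = coef (g S) P"
  proof (cases "finite S \<and> finite P")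
    case True
    then show ?thesis
      using fun_cong[OF eq, of "[set_encode P, set_encode S]"] by (simp add: encode_def)
  next
    case False
    then show ?thesis using f g by (auto simp: finsuppD finsuppD[OF coef_finsupp])
  qed
qed

lemma encode_add: "encode (\<lambda>S. f S + g S) = (\<lambda>xs. encode f xs + encode g xs)"
  by (auto simp: encode_def)

lemma encode_gscale: "encode (\<lambda>S. gscale c (f S)) = (\<lambda>xs. c * encode f xs)"
  by (auto simp: encode_def)

lemma finsupp_gscale: "f \<in> finsupp \<Longrightarrow> (\<lambda>S. gscale c (f S)) \<in> finsupp"
  by (auto simp: finsupp_def)

lemma conv_gscale_left: "conv b (\<lambda>S. gscale c (f S)) g = (\<lambda>S. gscale c (conv b f g S))"
  by (simp add: gscale_conv_times[of c "f _"] gscale_conv_times[of c "conv _ _ _ _"] conv_scale_left fun_eq_iff)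

lemma conv_gscale_right: "conv b f (\<lambda>S. gscale c (g S)) = (\<lambda>S. gscale c (conv b f g S))"
  by (simp add: gscale_conv_times[of c "g _"] gscale_conv_times[of c "conv _ _ _ _"] conv_scale_right fun_eq_iff)

section \<open>Commutators under ring homomorphisms, and the nilpotency class\<close>

lemma (in ring) lcomm_closed: "set us \<subseteq> carrier R \<Longrightarrow> lcomm R us \<in> carrier R"
proof (induction us rule: rev_induct)
  case (snoc x us)
  then show ?case by (cases "us = []") (auto simp: lcomm_snoc comm2_def)
qed simp

lemma (in ring_hom_ring) hom_lcomm:
  "set us \<subseteq> carrier R \<Longrightarrow> h (lcomm R us) = lcomm S (map h us)"
proof (induction us rule: rev_induct)
  case (snoc x us)
  then show ?case
    by (cases "us = []") (auto simp: lcomm_snoc comm2_def a_minus_def R.lcomm_closed)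
qed simp

lemma (in ring_hom_ring) hom_foldl_lcomm:
  assumes "\<And>i. i \<in> set is \<Longrightarrow> set (us i) \<subseteq> carrier R"
  shows "foldl (\<lambda>acc i. acc \<otimes> lcomm R (us i)) \<one> is \<in> carrier R
    \<and> h (foldl (\<lambda>acc i. acc \<otimes> lcomm R (us i)) \<one> is)
      = foldl (\<lambda>acc i. acc \<otimes>\<^bsub>S\<^esub> lcomm S (map h (us i))) \<one>\<^bsub>S\<^esub> is"
  using assms
  by (induction "is" rule: rev_induct) (auto simp: hom_lcomm R.lcomm_closed)

text \<open>Adding one to each odd \<open>m i\<close> gives
  \<open>2 * ((m i - 1) div 2) + 2\<close>, where positivity keeps the subtraction exact; summing
  absorbs \<open>l\<close> and \<open>2 * k\<close>.\<close>

lemma class_formula: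
  fixes k l :: nat and m :: "nat \<Rightarrow> nat"
  assumes "\<forall>i<k. m i > 0" "card {i. i < k \<and> odd (m i)} = l"
  shows "nat (int (\<Sum>i<k. m i) - 2 * int k + int l + 2) = 2 * (\<Sum>i<k. (m i - 1) div 2) + 2"
proof -
  have "m i + (if odd (m i) then 1 else 0) = 2 * ((m i - 1) div 2) + 2" if "i < k" for i
  proof -
    have "m i > 0" using assms(1) that by simp
    then show ?thesis by presburger
  qed
  then have "(\<Sum>i<k. m i + (if odd (m i) then 1 else 0)) = (\<Sum>i<k. 2 * ((m i - 1) div 2) + 2)"
    by (intro sum.cong) auto
  moreover have "(\<Sum>i<k. if odd (m i) then 1 else 0) = l"
  proof -
    have "(\<Sum>i<k. if odd (m i) then 1 else 0) = card ({..<k} \<inter> {i. odd (m i)})"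
      by (simp add: sum.If_cases)
    also have "{..<k} \<inter> {i. odd (m i)} = {i. i < k \<and> odd (m i)}" by auto
    finally show ?thesis using assms(2) by simp
  qed
  ultimately have "(\<Sum>i<k. m i) + l = 2 * (\<Sum>i<k. (m i - 1) div 2) + 2 * k"
    by (subst (asm) sum.distrib, subst (asm) sum.distrib) (simp add: sum_distrib_left)
  then show ?thesis by linarith
qed

theorem theorem1p9:
  fixes k l :: nat and m :: "nat \<Rightarrow> nat"
  assumes "k > 0" and "l \<le> k"
    and "\<forall>i<k. m i > 0"
    and "card {i. i < k \<and> odd (m i)} = l"
    and "card {i. i < k \<and> even (m i)} = k - l"
  shows "\<exists>(A :: (nat list \<Rightarrow> 'f::field) ring) (sm :: 'f \<Rightarrow> (nat list \<Rightarrow> 'f) \<Rightarrow> (nat list \<Rightarrow> 'f)).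
           unital_F_algebra sm A \<and>
           (let N = nat (int (\<Sum>i<k. m i) - 2 * int k + int l + 2) in
              Tn (1 + N) A = {\<zero>\<^bsub>A\<^esub>} \<and>
              (\<forall>us. length us = 1 + N \<and> set us \<subseteq> carrier A \<longrightarrow> lcomm A us = \<zero>\<^bsub>A\<^esub>)) \<and>
           (\<exists>v :: nat \<Rightarrow> nat \<Rightarrow> (nat list \<Rightarrow> 'f).
              (\<forall>i j. i < k \<and> j < m i \<longrightarrow> v i j \<in> carrier A) \<and>
              foldl (\<lambda>acc i. acc \<otimes>\<^bsub>A\<^esub> lcomm A (map (v i) [0..<m i])) \<one>\<^bsub>A\<^esub> [0..<k]
                \<noteq> \<zero>\<^bsub>A\<^esub>)"
proof -
  define r where "r i = 2 * ((m i - 1) div 2)" for i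
  define s where "s = (\<Sum>i<k. (m i - 1) div 2)"
  let ?R = "G.twisted_ring s :: (nat set \<Rightarrow> 'f grass) ring"
  \<comment> \<open>The ring is copied along the injection \<open>encode\<close> onto the required
    type.\<close>
  define A where "A = image_ring encode ?R"
  define sm where "sm = (\<lambda>(c :: 'f) (x :: nat list \<Rightarrow> 'f) xs. c * x xs)"
  have iso: "encode \<in> ring_iso ?R A"
    unfolding A_def by (rule inj_imp_image_ring_iso) (simp add: inj_on_encode)
  have ring_A: "ring A"
    unfolding A_def by (rule G.A.inj_imp_image_ring_is_ring) (simp add: inj_on_encode)
  interpret h: ring_hom_ring ?R A encode
    using iso ring_A G.ring_twisted_ring
    by (auto simp: ring_hom_ring_def ring_hom_ring_axioms_def ring_iso_def)
  have carr: "carrier A = encode ` finsupp"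
    by (simp add: A_def image_ring_carrier)
  have add: "encode f \<oplus>\<^bsub>A\<^esub> encode g = (\<lambda>xs. encode f xs + encode g xs)" if "f \<in> finsupp" "g \<in> finsupp" for f g :: "nat set \<Rightarrow> 'f grass"
    using h.hom_add[of f g] that by (simp add: encode_add)
  have mult: "encode f \<otimes>\<^bsub>A\<^esub> encode g = encode (conv (G.twist s) f g)" if "f \<in> finsupp" "g \<in> finsupp" for f g :: "nat set \<Rightarrow> 'f grass"
    using h.hom_mult[of f g] that by simp
  have sm: "sm c (encode f) = encode (\<lambda>S. gscale c (f S))" for c f
    by (simp add: sm_def encode_gscale)
  have alg: "unital_F_algebra sm A"
    unfolding unital_F_algebra_def
  proof (intro conjI allI impI ring_A)
    fix c d :: 'f and x y
    assume x: "x \<in> carrier A"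
    then obtain f where f: "x = encode f" "f \<in> finsupp" using carr by auto
    show "sm c x \<in> carrier A"
      using f by (simp add: sm carr finsupp_gscale)
    show "sm (c + d) x = sm c x \<oplus>\<^bsub>A\<^esub> sm d x"
      using f by (simp add: sm add finsupp_gscale) (simp add: encode_gscale algebra_simps)
    show "sm (c * d) x = sm c (sm d x)" "sm 1 x = x"
      by (simp_all add: sm_def mult.assoc)
    assume y: "y \<in> carrier A"
    then obtain g where g: "y = encode g" "g \<in> finsupp" using carr by auto
    show "sm c (x \<oplus>\<^bsub>A\<^esub> y) = sm c x \<oplus>\<^bsub>A\<^esub> sm c y"
      using f g by (simp add: sm add finsupp_gscale) (simp add: sm_def encode_gscale algebra_simps)
    show "sm c (x \<otimes>\<^bsub>A\<^esub> y) = sm c x \<otimes>\<^bsub>A\<^esub> y" "sm c (x \<otimes>\<^bsub>A\<^esub> y) = x \<otimes>\<^bsub>A\<^esub> sm c y"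
      using f g by (simp_all add: sm mult finsupp_gscale conv_gscale_left conv_gscale_right)
  qed
  have nilp: "lcomm A us = \<zero>\<^bsub>A\<^esub>" if us: "length us = 2 * s + 3" "set us \<subseteq> carrier A" for us
  proof -
    have "us \<in> lists (encode ` finsupp)" using us(2) carr by auto
    then obtain fs where fs: "us = map encode fs" "set fs \<subseteq> finsupp"
      unfolding lists_image by auto
    have "lcomm ?R fs = (\<lambda>_. 0)"
      using us(1) fs by (intro G.lie_nilpotent) (auto intro: low_degree_ge_top)
    then have "lcomm A us = encode (\<lambda>_. 0)" using h.hom_lcomm[of fs] fs by simp
    then show ?thesis using h.hom_zero by simp
  qed
  define v where "v i j = encode (mono_at (1 :: 'f grass) (entry (2 * s + (\<Sum>i<i. m i)) (\<Sum>i<i. r i) (r i) j))" for i j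
  have v: "v i j \<in> carrier A" for i j by (simp add: v_def carr)
  have nz: "foldl (\<lambda>acc i. acc \<otimes>\<^bsub>A\<^esub> lcomm A (map (v i) [0..<m i])) \<one>\<^bsub>A\<^esub> [0..<k] \<noteq> \<zero>\<^bsub>A\<^esub>"
  proof -
    define us where "us i = map (\<lambda>j. mono_at (1 :: 'f grass) (entry (2 * s + (\<Sum>i<i. m i)) (\<Sum>i<i. r i) (r i) j)) [0..<m i]" for i
    define p where "p = foldl (\<lambda>acc i. acc \<otimes>\<^bsub>?R\<^esub> lcomm ?R (us i)) \<one>\<^bsub>?R\<^esub> [0..<k]"
    have map_us: "map encode (us i) = map (v i) [0..<m i]" for i by (simp add: us_def v_def)
    have "set (us i) \<subseteq> carrier ?R" for i by (auto simp: us_def)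
    then have p: "p \<in> carrier ?R" "encode p = foldl (\<lambda>acc i. acc \<otimes>\<^bsub>A\<^esub> lcomm A (map (v i) [0..<m i])) \<one>\<^bsub>A\<^esub> [0..<k]"
      using h.hom_foldl_lcomm[of "[0..<k]" us] by (simp_all only: p_def map_us)
    have "(\<Sum>i<k. 2 * ((m i - 1) div 2)) = 2 * s" by (simp add: s_def sum_distrib_left)
    then obtain P S and c :: "'f grass" where "p = mono_at c S" "unit_gmon P c"
      using lcomm_products_nonzero[OF assms(3), of s k, where 'f = 'f] unfolding p_def us_def r_def by auto
    then have "p \<noteq> (\<lambda>_. 0)" using unit_gmon_nonzero by (auto simp: mono_at_def fun_eq_iff)
    moreover have "(\<lambda>_. 0) \<in> (finsupp :: (nat set \<Rightarrow> 'f grass) set)" by (simp add: finsupp_def)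
    ultimately have "encode p \<noteq> encode (\<lambda>_. 0)"
      using p(1) inj_onD[OF inj_on_encode, of p "\<lambda>_. 0"] by auto
    moreover have "encode (\<lambda>_. 0 :: 'f grass) = \<zero>\<^bsub>A\<^esub>" using h.hom_zero by simp
    ultimately show ?thesis using p(2) by simp
  qed
  have N: "nat (int (\<Sum>i<k. m i) - 2 * int k + int l + 2) = 2 * s + 2"
    unfolding s_def by (rule class_formula[OF assms(3,4)])
  have "Tn (1 + (2 * s + 2)) A = {\<zero>\<^bsub>A\<^esub>}"
  proof -
    \<comment> \<open>A list of zeros shows that the set of generators is not empty, so it equals
      the zero singleton.\<close>
    have "{lcomm A us |us. length us = 1 + (2 * s + 2) \<and> set us \<subseteq> carrier A} = {\<zero>\<^bsub>A\<^esub>}"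
    proof (intro equalityI subsetI)
      fix x assume "x \<in> {\<zero>\<^bsub>A\<^esub>}"
      moreover have "set (replicate (1 + (2 * s + 2)) \<zero>\<^bsub>A\<^esub>) \<subseteq> carrier A" by auto
      ultimately show "x \<in> {lcomm A us |us. length us = 1 + (2 * s + 2) \<and> set us \<subseteq> carrier A}"
        using nilp[of "replicate (1 + (2 * s + 2)) \<zero>\<^bsub>A\<^esub>"]
        by (intro CollectI exI[of _ "replicate (1 + (2 * s + 2)) \<zero>\<^bsub>A\<^esub>"]) auto
    qed (use nilp in auto)
    then show ?thesis unfolding Tn_def using h.S.genideal_zero by simp
  qed
  moreover have "\<forall>us. length us = 1 + (2 * s + 2) \<and> set us \<subseteq> carrier A \<longrightarrow> lcomm A us = \<zero>\<^bsub>A\<^esub>"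
    using nilp by auto
  ultimately show ?thesis
    using alg v nz unfolding Let_def N by blast
qed

end
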